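(* Let $F=\{f_i\}_{i\in I}$ be a finite frame for $\mathcal{H}^n$. If $F$ has a tight subframe, i.e. there is $J\subseteq I$ such that $\{f_i\}_{i\in J}$ is a tight frame for $\mathcal{H}^n$, then $F$ has a tight dual, i.e. a dual frame that is a tight frame for $\mathcal{H}^n$.
   Context: $\mathcal{H}^n$ denotes $\mathbb{R}^n$ or $\mathbb{C}^n$. A finite sequence $\{f_i\}_{i\in I}$ in $\mathcal{H}^n$ is a frame for $\mathcal{H}^n$ if there are constants $A,B>0$ with $A\|f\|^2\le\sum_{i\in I}|\langle f,f_i\rangle|^2\le B\|f\|^2$ for all $f\in\mathcal{H}^n$. It is a tight frame if one can take $A=B$. A frame $\{g_i\}_{i\in I}$ (zero vectors allowed) is a dual frame of $\{f_i\}_{i\in I}$ if $f=\sum_{i\in I}\langle f,f_i\rangle g_i$ for all $f\in\mathcal{H}^n$. *)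

theory Defs
  imports "HOL-Analysis.Analysis"
begin

text \<open>
  The notions below are stated for vectors over a normed field \<open>'k\<close> and take the inner product
  \<open>ip\<close> as a parameter, so that the real and the complex case share them: \<open>ip\<close> is \<open>(\<bullet>)\<close> on
  \<open>real ^ 'n\<close> and \<open>cinner\<close> on \<open>complex ^ 'n\<close>. On both types the library's \<open>norm\<close> is the
  Euclidean norm. A finite sequence is a function together with a finite index set.
\<close>

text \<open>
  The Hermitian inner product, linear in the first argument. The library's \<open>(\<bullet>)\<close> on
  \<open>complex ^ 'n\<close> is only its real part.
\<close>

definition cinner :: "complex ^ 'n \<Rightarrow> complex ^ 'n \<Rightarrow> complex" where
  "cinner x y = (\<Sum>j\<in>UNIV. x $ j * cnj (y $ j))"

definition frame_bounds ::
  "('k::real_normed_field ^ 'n \<Rightarrow> 'k ^ 'n \<Rightarrow> 'k) \<Rightarrow> 'i set \<Rightarrow> ('i \<Rightarrow> 'k ^ 'n) \<Rightarrow> real \<Rightarrow> real \<Rightarrow> bool"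
  where
  "frame_bounds ip I f A B \<longleftrightarrow> A > 0 \<and> B > 0 \<and>
     (\<forall>x. A * (norm x)\<^sup>2 \<le> (\<Sum>i\<in>I. (norm (ip x (f i)))\<^sup>2) \<and>
          (\<Sum>i\<in>I. (norm (ip x (f i)))\<^sup>2) \<le> B * (norm x)\<^sup>2)"

definition is_frame ::
  "('k::real_normed_field ^ 'n \<Rightarrow> 'k ^ 'n \<Rightarrow> 'k) \<Rightarrow> 'i set \<Rightarrow> ('i \<Rightarrow> 'k ^ 'n) \<Rightarrow> bool" where
  "is_frame ip I f \<longleftrightarrow> finite I \<and> (\<exists>A B. frame_bounds ip I f A B)"

definition is_tight_frame ::
  "('k::real_normed_field ^ 'n \<Rightarrow> 'k ^ 'n \<Rightarrow> 'k) \<Rightarrow> 'i set \<Rightarrow> ('i \<Rightarrow> 'k ^ 'n) \<Rightarrow> bool" where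
  "is_tight_frame ip I f \<longleftrightarrow> finite I \<and> (\<exists>A. frame_bounds ip I f A A)"

definition is_dual_frame ::
  "('k::real_normed_field ^ 'n \<Rightarrow> 'k ^ 'n \<Rightarrow> 'k) \<Rightarrow> 'i set \<Rightarrow> ('i \<Rightarrow> 'k ^ 'n) \<Rightarrow> ('i \<Rightarrow> 'k ^ 'n) \<Rightarrow> bool"
  where
  "is_dual_frame ip I f g \<longleftrightarrow> is_frame ip I g \<and> (\<forall>x. x = (\<Sum>i\<in>I. ip x (f i) *s g i))"

end

theory Submission imports Defs begin

text \<open>
  A tight frame with bound \<open>A\<close> satisfies \<open>(\<Sum>i\<in>J. \<langle>x, f i\<rangle> f i) = A x\<close> by polarization. Hence the
  sequence \<open>f i / A\<close> for \<open>i \<in> J\<close>, padded with zeros on \<open>I - J\<close>, is dual to \<open>f\<close>, and it is tight with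
  bound \<open>1 / A\<close>.

  The real and the complex case are treated together: all that is used of \<open>ip\<close> is
  \<open>(c *s v) \<bullet> y = c \<bullet> ip y v\<close>, where \<open>(\<bullet>)\<close> is the real inner product, on the scalars on the right.
  It determines \<open>ip\<close>.
\<close>

locale adjoint_ip =
  fixes ip :: "'k::{real_normed_field,real_inner} ^ 'n \<Rightarrow> 'k ^ 'n \<Rightarrow> 'k"
  assumes inner_scale_left: "(c *s v) \<bullet> y = c \<bullet> ip y v"
begin

text \<open>A scalar is determined by its real inner products with all scalars \<open>c\<close>; the
  locale assumption turns these into inner products of vectors, where additivity is known.\<close>

lemma ip_add_left: "ip (x + y) v = ip x v + ip y v"
  by (rule vector_eq_ldot[THEN iffD1])
    (simp add: inner_add_right flip: inner_scale_left)

lemma ip_scaleR_right: "ip x (r *\<^sub>R v) = r *\<^sub>R ip x v"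
proof (rule vector_eq_ldot[THEN iffD1], intro allI)
  fix c :: 'k
  have "c *s (r *\<^sub>R v) = r *\<^sub>R (c *s v)"
    by (simp add: vec_eq_iff)
  then show "c \<bullet> ip x (r *\<^sub>R v) = c \<bullet> (r *\<^sub>R ip x v)"
    by (metis inner_scale_left inner_scaleR_left inner_scaleR_right)
qed

lemma ip_zero_right: "ip x 0 = 0"
  using ip_scaleR_right[of x 0 0] by simp

text \<open>Real polarization suffices even for complex scalars, since a vector is determined by its
  real inner products with all \<open>y\<close>.\<close>

lemma tight_frame_expansion:
  assumes bound: "\<And>x. (\<Sum>i\<in>J. (norm (ip x (f i)))\<^sup>2) = A * (norm x)\<^sup>2"
  shows "(\<Sum>i\<in>J. ip x (f i) *s f i) = A *\<^sub>R x"
proof (rule vector_eq_rdot[THEN iffD1], intro allI)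
  fix y
  have "2 * (\<Sum>i\<in>J. ip x (f i) \<bullet> ip y (f i)) =
      (\<Sum>i\<in>J. (norm (ip (x + y) (f i)))\<^sup>2 - (norm (ip x (f i)))\<^sup>2 - (norm (ip y (f i)))\<^sup>2)"
    by (simp add: sum_distrib_left ip_add_left power2_norm_eq_inner inner_add_left inner_add_right
        inner_commute)
  also have "\<dots> = A * (norm (x + y))\<^sup>2 - A * (norm x)\<^sup>2 - A * (norm y)\<^sup>2"
    by (simp add: sum_subtractf bound)
  also have "\<dots> = 2 * ((A *\<^sub>R x) \<bullet> y)"
    by (simp add: power2_norm_eq_inner inner_add_left inner_add_right inner_commute algebra_simps)
  \<comment> \<open>The locale assumption with \<open>c = ip x (f i)\<close> turns each summand into
    the polarized cross term.\<close>
  finally show "(\<Sum>i\<in>J. ip x (f i) *s f i) \<bullet> y = (A *\<^sub>R x) \<bullet> y"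
    by (simp add: inner_sum_left inner_scale_left)
qed

theorem tight_dual_if_tight_subframe:
  assumes "finite I" "J \<subseteq> I" "is_tight_frame ip J f"
  shows "\<exists>g. is_dual_frame ip I f g \<and> is_tight_frame ip I g"
proof -
  obtain A where A: "frame_bounds ip J f A A"
    using assms(3) by (auto simp: is_tight_frame_def)
  then have "A > 0"
    by (simp add: frame_bounds_def)
  have bound: "(\<Sum>i\<in>J. (norm (ip x (f i)))\<^sup>2) = A * (norm x)\<^sup>2" for x
    using A by (auto simp: frame_bounds_def intro: antisym)
  define g where "g i = (if i \<in> J then (1 / A) *\<^sub>R f i else 0)" for i
  have "(\<Sum>i\<in>I. (norm (ip x (g i)))\<^sup>2) = (1 / A) * (norm x)\<^sup>2" for x
  proof -
    have "(\<Sum>i\<in>I. (norm (ip x (g i)))\<^sup>2) = (\<Sum>i\<in>J. (norm (ip x (g i)))\<^sup>2)"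
      using assms by (intro sum.mono_neutral_right) (auto simp: g_def ip_zero_right)
    also have "\<dots> = (\<Sum>i\<in>J. (1 / A)\<^sup>2 * (norm (ip x (f i)))\<^sup>2)"
      by (simp add: g_def ip_scaleR_right power_divide)
    also have "\<dots> = (1 / A)\<^sup>2 * (A * (norm x)\<^sup>2)"
      by (simp only: bound flip: sum_distrib_left)
    also have "\<dots> = (1 / A) * (norm x)\<^sup>2"
      using \<open>A > 0\<close> by (simp add: power2_eq_square)
    finally show ?thesis .
  qed
  then have g: "frame_bounds ip I g (1 / A) (1 / A)"
    using \<open>A > 0\<close> by (simp add: frame_bounds_def)
  have "(\<Sum>i\<in>I. ip x (f i) *s g i) = x" for x
  proof -
    have "(\<Sum>i\<in>I. ip x (f i) *s g i) = (\<Sum>i\<in>J. ip x (f i) *s g i)"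
      using assms by (intro sum.mono_neutral_right) (auto simp: g_def)
    also have "\<dots> = (\<Sum>i\<in>J. (1 / A) *\<^sub>R (ip x (f i) *s f i))"
      by (intro sum.cong) (auto simp: g_def vec_eq_iff)
    also have "\<dots> = x"
      using \<open>A > 0\<close> by (simp add: tight_frame_expansion[OF bound] flip: scaleR_sum_right)
    finally show ?thesis .
  qed
  with g \<open>finite I\<close> show ?thesis
    unfolding is_dual_frame_def is_frame_def is_tight_frame_def by metis
qed

end

interpretation real_ip: adjoint_ip "(\<bullet>) :: real ^ 'n \<Rightarrow> real ^ 'n \<Rightarrow> real"
  by unfold_locales (simp add: inner_vec_def sum_distrib_left mult_ac)

interpretation complex_ip: adjoint_ip "cinner :: complex ^ 'n \<Rightarrow> complex ^ 'n \<Rightarrow> complex"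
  by unfold_locales
    (unfold inner_vec_def cinner_def inner_sum_right, intro sum.cong refl,
      simp add: inner_complex_def algebra_simps)

theorem corollary4p7:
  "(\<forall>(I :: 'i set) (f :: 'i \<Rightarrow> real ^ 'n).
      is_frame (\<bullet>) I f \<longrightarrow> (\<exists>J\<subseteq>I. is_tight_frame (\<bullet>) J f) \<longrightarrow>
      (\<exists>g. is_dual_frame (\<bullet>) I f g \<and> is_tight_frame (\<bullet>) I g)) \<and>
   (\<forall>(I :: 'i set) (f :: 'i \<Rightarrow> complex ^ 'n).
      is_frame cinner I f \<longrightarrow> (\<exists>J\<subseteq>I. is_tight_frame cinner J f) \<longrightarrow>
      (\<exists>g. is_dual_frame cinner I f g \<and> is_tight_frame cinner I g))"
  by (meson is_frame_def real_ip.tight_dual_if_tight_subframe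
      complex_ip.tight_dual_if_tight_subframe)

end
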